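(* Let $q=2^k$ with $k\ge 1$, let $n$ be a positive integer, and let $t\in \mathrm{GF}(q)^*$, $s\in\mathrm{GF}(q)$. Then \[ nP(n,0,s)=\sum_{\substack{d\mid n\\ d\text{ odd}}}\mu(d)\Big(F(n/d,0,s)-[n\text{ even}]\,q^{n/(2d)-1}\Big), \] and \[ nP(n,t,s)=\sum_{\substack{d\mid n\\ d\equiv 1 \pmod 4}}\mu(d)\,F(n/d,t,s)+\sum_{\substack{d\mid n\\ d\equiv 3\pmod 4}}\mu(d)\,F(n/d,t,t^2+s). \]
   Context: $\mu$ is the Möbius function. For a proposition $P$, $[P]$ equals $1$ if $P$ is true and $0$ otherwise. For a monic polynomial $p(x)$ of degree $N$ over $\mathrm{GF}(q)$ with roots $\beta_1,\dots,\beta_N$ (in a splitting field), its trace is $Tr(p)=\sum_i\beta_i$ and its subtrace is $St(p)=\sum_{i<j}\beta_i\beta_j$; in characteristic 2 these are the coefficients of $x^{N-1}$ and $x^{N-2}$ respectively (the subtrace is $0$ when $N=1$). For $\beta\in\mathrm{GF}(q^N)$, $Tr(\beta)=\sum_{i=0}^{N-1}\beta^{q^i}$ and $St(\beta)=\sum_{0\le i<j<N}\beta^{q^i}\beta^{q^j}$. $P(N,t,s)$ denotes the number of monic irreducible polynomials of degree $N$ over $\mathrm{GF}(q)$ with trace $t$ and subtrace $s$, and $F(N,t,s)$ denotes the number of elements $\beta\in\mathrm{GF}(q^N)$ with $Tr(\beta)=t$ and $St(\beta)=s$. *)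

theory Defs
  imports
    "HOL-Algebra.Algebraic_Closure_Type"
    "HOL-Computational_Algebra.Squarefree"
    "HOL-Library.Cardinality"
begin

text \<open>
  The base field $\mathrm{GF}(q)$ is a type \<open>'a\<close> of class \<open>finite_field\<close> with
  \<open>CARD('a) = q\<close>. All extensions $\mathrm{GF}(q^N)$ and all roots of polynomials over
  $\mathrm{GF}(q)$ live in the algebraic closure \<open>'a alg_closure\<close>, into which
  \<open>to_ac\<close> embeds \<open>'a\<close>. \<open>HOL-Algebra\<close> reuses some names of the polynomial library,
  hence the qualified names below.
\<close>

definition moebius :: "nat \<Rightarrow> int" where
  "moebius n = (if squarefree n then (-1) ^ card (prime_factors n) else 0)"

text \<open>
  $\mathrm{GF}(q^N)$ is the set of roots of $X^{q^N} - X$; by \<open>GF_ext_unique\<close> below it is the only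
  subfield of the algebraic closure with $q^N$ elements.
\<close>

definition GF_ext :: "nat \<Rightarrow> ('a :: finite_field) alg_closure set" where
  "GF_ext N = {\<beta>. \<beta> ^ (CARD('a) ^ N) = \<beta>}"

definition elem_trace :: "nat \<Rightarrow> ('a :: finite_field) alg_closure \<Rightarrow> 'a alg_closure" where
  "elem_trace N \<beta> = (\<Sum>i<N. \<beta> ^ (CARD('a) ^ i))"

definition elem_subtrace :: "nat \<Rightarrow> ('a :: finite_field) alg_closure \<Rightarrow> 'a alg_closure" where
  "elem_subtrace N \<beta> = (\<Sum>j<N. \<Sum>i<j. \<beta> ^ (CARD('a) ^ i) * \<beta> ^ (CARD('a) ^ j))"

definition F :: "nat \<Rightarrow> 'a \<Rightarrow> 'a :: finite_field \<Rightarrow> nat" where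
  "F N t s = card {\<beta> \<in> GF_ext N. elem_trace N \<beta> = to_ac t \<and> elem_subtrace N \<beta> = to_ac s}"

text \<open>
  The roots $\beta_1, \dots, \beta_N$ of a polynomial, with multiplicity and in an arbitrary order
  (on which trace and subtrace do not depend, by \<open>poly_trace_coeff\<close> and
  \<open>poly_subtrace_coeff\<close>).
\<close>

definition poly_root_list :: "'a :: field poly \<Rightarrow> 'a alg_closure list" where
  "poly_root_list p = (SOME bs. mset bs = proots (map_poly to_ac p))"

definition poly_trace :: "'a :: field poly \<Rightarrow> 'a alg_closure" where
  "poly_trace p = (let bs = poly_root_list p in \<Sum>i<length bs. bs ! i)"

definition poly_subtrace :: "'a :: field poly \<Rightarrow> 'a alg_closure" where
  "poly_subtrace p = (let bs = poly_root_list p in \<Sum>j<length bs. \<Sum>i<j. bs ! i * bs ! j)"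

definition P :: "nat \<Rightarrow> 'a \<Rightarrow> 'a :: finite_field \<Rightarrow> nat" where
  "P N t s = card {p :: 'a poly. Polynomial.lead_coeff p = 1 \<and> Factorial_Ring.irreducible p \<and>
     Polynomial.degree p = N \<and> poly_trace p = to_ac t \<and> poly_subtrace p = to_ac s}"


subsection \<open>Adequacy of the definitions\<close>

lemma mset_poly_root_list: "mset (poly_root_list p) = proots (map_poly to_ac p)"
  unfolding poly_root_list_def by (rule someI_ex) (rule ex_mset)

lemma proots_linear_factors:
  fixes A :: "'b :: idom multiset"
  shows "proots (\<Prod>x\<in>#A. [:-x, 1:]) = A"
proof (induction A)
  case (add x A)
  have "(\<Prod>x\<in>#A. [:-x, 1:]) \<noteq> 0"
    by (auto simp: prod_mset_zero_iff)
  thus ?case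
    using add.IH by (simp add: proots_mult del: mult_pCons_left)
qed auto

lemma poly_root_list_splits:
  assumes "Polynomial.lead_coeff p = 1"
  shows "map_poly to_ac p = (\<Prod>b\<leftarrow>poly_root_list p. [:-b, 1:])"
    and "length (poly_root_list p) = Polynomial.degree p"
proof -
  let ?p = "map_poly to_ac p"
  have deg: "Polynomial.degree ?p = Polynomial.degree p"
    by (intro degree_map_poly) auto
  have lc: "Polynomial.lead_coeff ?p = 1"
    using assms by (simp add: deg coeff_map_poly)
  hence "?p \<noteq> 0" by auto
  from alg_closed_imp_factorization[OF this] obtain A where
    A: "size A = Polynomial.degree ?p" "?p = (\<Prod>x\<in>#A. [:-x, 1:])"
    using lc by auto
  have pr: "mset (poly_root_list p) = A"
    unfolding mset_poly_root_list A(2) by (rule proots_linear_factors)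
  show "length (poly_root_list p) = Polynomial.degree p"
    using A(1) pr deg by (metis size_mset)
  have "(\<Prod>b\<leftarrow>poly_root_list p. [:-b, 1:]) = prod_mset (image_mset (\<lambda>x. [:-x, 1:]) A)"
    unfolding pr[symmetric] by (simp flip: prod_mset_prod_list mset_map)
  thus "?p = (\<Prod>b\<leftarrow>poly_root_list p. [:-b, 1:])"
    using A(2) by simp
qed

lemma coeff_linear_factors:
  fixes bs :: "'b :: idom list"
  defines "p \<equiv> (\<Prod>b\<leftarrow>bs. [:-b, 1:])"
  shows "Polynomial.degree p = length bs" "Polynomial.coeff p (length bs) = 1"
    and "length bs \<ge> 1 \<Longrightarrow> Polynomial.coeff p (length bs - 1) = - (\<Sum>i<length bs. bs ! i)"
    and "length bs \<ge> 2 \<Longrightarrow>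
           Polynomial.coeff p (length bs - 2) = (\<Sum>j<length bs. \<Sum>i<j. bs ! i * bs ! j)"
proof -
  have "Polynomial.degree p = length bs \<and> Polynomial.coeff p (length bs) = 1 \<and>
     (length bs \<ge> 1 \<longrightarrow> Polynomial.coeff p (length bs - 1) = - (\<Sum>i<length bs. bs ! i)) \<and>
     (length bs \<ge> 2 \<longrightarrow>
        Polynomial.coeff p (length bs - 2) = (\<Sum>j<length bs. \<Sum>i<j. bs ! i * bs ! j))"
    unfolding p_def
  proof (induction bs rule: rev_induct)
    case Nil
    show ?case by simp
  next
    case (snoc b bs)
    define q where "q = (\<Prod>b\<leftarrow>bs. [:-b, 1:])"
    define N where "N = length bs"
    note IH = snoc.IH[folded q_def N_def]
    have q0: "q \<noteq> 0" using IH by auto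
    have eq: "(\<Prod>b\<leftarrow>bs @ [b]. [:-b, 1:]) = [:-b, 1:] * q"
      by (simp add: q_def mult.commute)
    have e1: "(\<Sum>i<Suc N. (bs @ [b]) ! i) = (\<Sum>i<N. bs ! i) + b"
      by (simp add: N_def nth_append)
    have "(\<Sum>j<N. \<Sum>i<j. (bs @ [b]) ! i * (bs @ [b]) ! j) = (\<Sum>j<N. \<Sum>i<j. bs ! i * bs ! j)"
      by (intro sum.cong refl) (auto simp: N_def nth_append)
    moreover have "(\<Sum>i<N. (bs @ [b]) ! i * (bs @ [b]) ! N) = (\<Sum>i<N. bs ! i) * b"
      unfolding sum_distrib_right by (intro sum.cong refl) (auto simp: N_def nth_append)
    ultimately have e2: "(\<Sum>j<Suc N. \<Sum>i<j. (bs @ [b]) ! i * (bs @ [b]) ! j) =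
        (\<Sum>j<N. \<Sum>i<j. bs ! i * bs ! j) + (\<Sum>i<N. bs ! i) * b"
      by simp
    have c: "Polynomial.coeff ([:-b, 1:] * q) (Suc i) =
               Polynomial.coeff q i - b * Polynomial.coeff q (Suc i)" for i
      by simp
    have c0: "Polynomial.coeff ([:-b, 1:] * q) 0 = - b * Polynomial.coeff q 0"
      by simp
    have len: "length (bs @ [b]) = Suc N"
      by (simp add: N_def)
    have deg: "Polynomial.degree ([:-b, 1:] * q) = Suc N"
      using q0 IH by (subst degree_mult_eq) auto
    have top: "Polynomial.coeff q (Suc N) = 0"
      using IH by (intro coeff_eq_0) auto
    have A: "Polynomial.coeff ([:-b, 1:] * q) (Suc N) = 1"
      unfolding c top using IH by simp
    have B: "Polynomial.coeff ([:-b, 1:] * q) (Suc N - 1) = - (\<Sum>i<Suc N. (bs @ [b]) ! i)"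
    proof (cases N)
      case 0
      thus ?thesis using IH c0 e1 by simp
    next
      case (Suc M)
      have "Polynomial.coeff ([:-b, 1:] * q) (Suc M) =
              - (\<Sum>i<N. bs ! i) - b * Polynomial.coeff q N"
        unfolding c using IH Suc by simp
      thus ?thesis using e1 IH Suc by simp
    qed
    have C: "Polynomial.coeff ([:-b, 1:] * q) (Suc N - 2) =
               (\<Sum>j<Suc N. \<Sum>i<j. (bs @ [b]) ! i * (bs @ [b]) ! j)" if N: "Suc N \<ge> 2"
    proof (cases "N = 1")
      case True
      thus ?thesis using IH c0 e2 by simp
    next
      case False
      with N obtain M where M: "N = Suc (Suc M)"
        by (metis One_nat_def Suc_1 Suc_le_D Suc_le_mono not0_implies_Suc)
      have "Polynomial.coeff ([:-b, 1:] * q) (Suc M) =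
              Polynomial.coeff q (N - 2) - b * Polynomial.coeff q (N - 1)"
        unfolding c using M by simp
      also have "\<dots> = (\<Sum>j<N. \<Sum>i<j. bs ! i * bs ! j) + (\<Sum>i<N. bs ! i) * b"
        using IH M by (simp del: sum.lessThan_Suc add: mult.commute)
      finally show ?thesis using e2 M by simp
    qed
    show ?case
      unfolding eq len using deg A B C by blast
  qed
  thus "Polynomial.degree p = length bs" "Polynomial.coeff p (length bs) = 1"
    and "length bs \<ge> 1 \<Longrightarrow> Polynomial.coeff p (length bs - 1) = - (\<Sum>i<length bs. bs ! i)"
    and "length bs \<ge> 2 \<Longrightarrow>
           Polynomial.coeff p (length bs - 2) = (\<Sum>j<length bs. \<Sum>i<j. bs ! i * bs ! j)"
    by blast+
qed

lemma poly_trace_coeff: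
  assumes "Polynomial.lead_coeff p = 1" "Polynomial.degree p \<ge> 1"
  shows "poly_trace p = - to_ac (Polynomial.coeff p (Polynomial.degree p - 1))"
  using coeff_linear_factors(3)[of "poly_root_list p"] assms(2)
        poly_root_list_splits(2)[OF assms(1)]
  by (simp add: poly_trace_def Let_def coeff_map_poly
           flip: poly_root_list_splits(1)[OF assms(1)])

lemma poly_subtrace_coeff:
  assumes "Polynomial.lead_coeff p = 1" "Polynomial.degree p \<ge> 2"
  shows "poly_subtrace p = to_ac (Polynomial.coeff p (Polynomial.degree p - 2))"
  using coeff_linear_factors(4)[of "poly_root_list p"] assms(2)
        poly_root_list_splits(2)[OF assms(1)]
  by (simp add: poly_subtrace_def Let_def coeff_map_poly
           flip: poly_root_list_splits(1)[OF assms(1)])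

lemma poly_subtrace_degree_1:
  assumes "Polynomial.lead_coeff p = 1" "Polynomial.degree p = 1"
  shows "poly_subtrace p = 0"
  using poly_root_list_splits(2)[OF assms(1)] assms(2)
  by (simp add: poly_subtrace_def Let_def)

lemma CHAR_eq_2:
  assumes "CARD('a :: finite_field) = 2 ^ k"
  shows "CHAR('a) = 2"
proof -
  have "(\<Sum>x\<in>(UNIV :: 'a set). x + 1) = (\<Sum>x\<in>UNIV. x)"
    by (rule sum.reindex_bij_witness[of _ "\<lambda>x. x - 1" "\<lambda>x. x + 1"]) auto
  hence "of_nat CARD('a) = (0 :: 'a)"
    by (simp add: sum.distrib)
  hence "CHAR('a) dvd 2 ^ k"
    using assms by (metis of_nat_eq_0_iff_char_dvd)
  moreover have "Factorial_Ring.prime CHAR('a)"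
    by simp
  ultimately show ?thesis
    by (metis prime_dvd_power primes_dvd_imp_eq two_is_prime_nat)
qed

lemma GF_ext_subfield:
  assumes "CARD('a :: finite_field) = 2 ^ k"
  shows "to_ac (c :: 'a) \<in> GF_ext N"
    and "(x :: 'a alg_closure) \<in> GF_ext N \<Longrightarrow> y \<in> GF_ext N \<Longrightarrow> x + y \<in> GF_ext N"
    and "(x :: 'a alg_closure) \<in> GF_ext N \<Longrightarrow> - x \<in> GF_ext N"
    and "(x :: 'a alg_closure) \<in> GF_ext N \<Longrightarrow> y \<in> GF_ext N \<Longrightarrow> x * y \<in> GF_ext N"
    and "(x :: 'a alg_closure) \<in> GF_ext N \<Longrightarrow> inverse x \<in> GF_ext N"
proof -
  have ch: "CHAR('a alg_closure) = 2"
    using CHAR_eq_2[OF assms] by simp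
  have q: "CARD('a) ^ N = CHAR('a alg_closure) ^ (k * N)"
    unfolding ch assms by (simp add: power_mult)
  have "to_ac c ^ (CARD('a) ^ N) = to_ac (c ^ (CARD('a) ^ N))"
    by simp
  also have "c ^ (CARD('a) ^ N) = c"
    by (rule finite_field_power_card_power_eq_same) auto
  finally show "to_ac c \<in> GF_ext N"
    by (simp add: GF_ext_def)
  show "x + y \<in> GF_ext N" if "x \<in> GF_ext N" "y \<in> GF_ext N" for x y :: "'a alg_closure"
    using that freshmans_dream'[of "CARD('a) ^ N" "k * N" x y] q ch
    by (simp add: GF_ext_def)
  show "- x \<in> GF_ext N" if "x \<in> GF_ext N" for x :: "'a alg_closure"
    using that by (simp only: uminus_CHAR_2[OF ch])
  show "x * y \<in> GF_ext N" if "x \<in> GF_ext N" "y \<in> GF_ext N" for x y :: "'a alg_closure"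
    using that by (simp add: GF_ext_def power_mult_distrib)
  show "inverse x \<in> GF_ext N" if "x \<in> GF_ext N" for x :: "'a alg_closure"
    using that by (simp add: GF_ext_def power_inverse)
qed

lemma finite_GF_ext_card:
  assumes "CARD('a :: finite_field) = 2 ^ k" "k \<ge> 1" "N \<ge> 1"
  shows "finite (GF_ext N :: 'a alg_closure set)"
    and "card (GF_ext N :: 'a alg_closure set) = CARD('a) ^ N"
proof -
  define m where "m = CARD('a) ^ N"
  have "m = 2 ^ (k * N)"
    by (simp add: m_def assms(1) power_mult)
  moreover have "k * N > 0"
    using assms(2,3) by simp
  ultimately have m: "m > 1" "even m"
    using one_less_power[of "2 :: nat" "k * N"] by auto
  define f :: "'a alg_closure poly" where "f = Polynomial.monom 1 m - Polynomial.monom 1 1"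
  have cf: "Polynomial.coeff f m = 1"
    using m by (simp add: f_def)
  have deg: "Polynomial.degree f = m"
  proof (rule antisym)
    show "Polynomial.degree f \<le> m"
      unfolding f_def using m by (intro degree_diff_le) (auto simp: degree_monom_eq)
    show "m \<le> Polynomial.degree f"
      using cf by (intro le_degree) auto
  qed
  have f0: "f \<noteq> 0" using cf by auto
  have roots: "{x. poly f x = 0} = GF_ext N"
    by (auto simp: f_def GF_ext_def poly_monom m_def)
  have "CHAR('a alg_closure) = 2"
    using CHAR_eq_2[OF assms(1)] by simp
  hence "of_nat m = (0 :: 'a alg_closure)"
    using m(2) by (simp add: of_nat_eq_0_iff_char_dvd)
  hence pd: "pderiv f = -1"
    by (simp add: f_def pderiv_diff pderiv_monom)
  have ord: "order x f \<le> 1" for x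
  proof (rule ccontr)
    assume "\<not> order x f \<le> 1"
    hence "[:-x, 1:] ^ 2 dvd f"
      by (simp add: order_divides f0)
    then obtain g where "f = [:-x, 1:] ^ 2 * g" ..
    hence "poly (pderiv f) x = 0"
      by (simp add: pderiv_mult power2_eq_square pderiv_pCons del: mult_pCons_left mult_pCons_right)
    thus False by (simp add: pd)
  qed
  obtain A where A: "size A = Polynomial.degree f" "f = (\<Prod>x\<in>#A. [:-x, 1:])"
    using alg_closed_imp_factorization[OF f0] cf deg by auto
  have PA: "proots f = A"
    unfolding A(2) by (rule proots_linear_factors)
  have "count A x \<le> 1" for x
    using ord[of x] f0 by (simp flip: PA)
  hence "count A x = (if x \<in> set_mset A then 1 else 0)" for x
    by (metis One_nat_def Suc_leI count_eq_zero_iff le_antisym not_gr_zero)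
  hence "size A = card (set_mset A)"
    by (simp add: size_multiset_overloaded_eq)
  moreover have sA: "set_mset A = GF_ext N"
    using f0 roots PA by (metis set_count_proots)
  ultimately show "card (GF_ext N :: 'a alg_closure set) = CARD('a) ^ N"
    using A(1) deg m_def by simp
  show "finite (GF_ext N :: 'a alg_closure set)"
    using sA by (metis finite_set_mset)
qed

lemma GF_ext_unique:
  fixes K :: "('a :: finite_field) alg_closure set"
  assumes "CARD('a) = 2 ^ k" "k \<ge> 1" "N \<ge> 1"
    and "0 \<in> K" and mult: "\<And>x y. x \<in> K \<Longrightarrow> y \<in> K \<Longrightarrow> x * y \<in> K"
    and inv: "\<And>x. x \<in> K \<Longrightarrow> inverse x \<in> K"
    and card: "card K = CARD('a) ^ N"
  shows "K = GF_ext N"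
proof -
  have "card K > 0" unfolding card by simp
  hence fin: "finite K" using card_gt_0_iff by blast
  have "x ^ card K = x" if x: "x \<in> K" for x
  proof (cases "x = 0")
    case False
    have "(\<Prod>y\<in>K-{0}. x * y) = (\<Prod>y\<in>K-{0}. y)"
      by (rule prod.reindex_bij_witness[of _ "\<lambda>y. inverse x * y" "\<lambda>y. x * y"])
         (use False x mult inv in \<open>auto simp: mult.assoc[symmetric]\<close>)
    hence "x ^ (card (K - {0})) * \<Prod>(K-{0}) = \<Prod>(K-{0})"
      by (simp add: prod.distrib)
    moreover have "\<Prod>(K-{0}) \<noteq> 0" using fin by auto
    ultimately have "x ^ (card K - 1) = 1"
      using fin \<open>0 \<in> K\<close> by simp
    hence "x ^ Suc (card K - 1) = x" by simp
    thus ?thesis using \<open>card K > 0\<close> by simp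
  qed (use \<open>card K > 0\<close> in auto)
  hence "K \<subseteq> GF_ext N"
    unfolding GF_ext_def card by auto
  thus ?thesis
    using finite_GF_ext_card[OF assms(1-3)] card by (intro card_subset_eq) auto
qed

end

theory Submission
  imports Defs
begin

text \<open>
  Classify the elements of $\mathrm{GF}(q^n)$ by their degree $m$ over $\mathrm{GF}(q)$ and write
  $n = dm$. The characteristic polynomial of such an element is the $d$-th power of its minimal
  polynomial, so its trace is $d$ times, and its subtrace is $d\,s' + \binom{d}{2} t'^2$ in terms
  of, the trace $t'$ and subtrace $s'$ of the minimal polynomial. In characteristic 2, an odd $d$
  fixes the trace and shifts the subtrace by $t'^2$ iff $d \equiv 3 \pmod 4$; as these
  shifts add up when odd indices are multiplied, a twisted Moebius inversion over the odd divisors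
  applies. The elements
  with $d$ even are exactly those of $\mathrm{GF}(q^{n/2})$; they have trace $0$ and subtrace
  $Tr_{n/2}(\beta)^2$, so they contribute $q^{n/2-1}$ when $t = 0$ and nothing otherwise.
\<close>

subsection \<open>Moebius inversion over odd divisors\<close>

text \<open>A new prime adds exactly one prime factor and does not affect squarefreeness, so only
  the sign changes.\<close>

lemma moebius_prime_mult:
  assumes "Factorial_Ring.prime p" "\<not> p dvd d" "d > 0"
  shows "moebius (p * d) = - moebius d"
proof -
  have "coprime p d"
    using assms by (simp add: prime_imp_coprime)
  hence sf: "squarefree (p * d) \<longleftrightarrow> squarefree d"
    using assms by (metis squarefree_mult_coprime squarefree_multD(2) squarefree_prime)
  have "prime_factors (p * d) = insert p (prime_factors d)"
    using assms by (auto simp: prime_factors_product prime_prime_factors)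
  moreover have "p \<notin> prime_factors d" using assms(2) by auto
  ultimately show ?thesis by (simp add: moebius_def sf)
qed

text \<open>For a fixed prime \<open>p\<close> dividing \<open>n\<close>, the divisors
  \<open>d\<close> and \<open>p * d\<close> with \<open>d\<close> prime to \<open>p\<close> cancel
  in pairs.\<close>

lemma sum_moebius_divisors:
  assumes "n > 0"
  shows "(\<Sum>d | d dvd n. moebius d) = of_bool (n = 1)"
proof (cases "n = 1")
  case False
  then obtain p where p: "Factorial_Ring.prime p" "p dvd n"
    using prime_factor_nat by blast
  have fin: "finite {d. d dvd n}" using assms by simp
  \<comment> \<open>These are the divisors that \<open>p\<close> divides zero times and exactly
    once; on all others \<open>moebius\<close> vanishes.\<close>
  let ?A = "{d. d dvd n \<and> \<not> p dvd d}" and ?B = "{d. d dvd n \<and> p dvd d \<and> \<not> p\<^sup>2 dvd d}"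
  have "(\<Sum>d | d dvd n. moebius d) = (\<Sum>d\<in>?A \<union> ?B. moebius d)"
  proof (rule sum.mono_neutral_right[OF fin])
    show "\<forall>d\<in>{d. d dvd n} - (?A \<union> ?B). moebius d = 0"
    proof
      fix d assume "d \<in> {d. d dvd n} - (?A \<union> ?B)"
      hence "p\<^sup>2 dvd d" by blast
      hence "\<not> squarefree d"
        by (rule not_squarefreeI) (use p in auto)
      thus "moebius d = 0" by (simp add: moebius_def)
    qed
  qed blast
  also have "\<dots> = (\<Sum>d\<in>?A. moebius d) + (\<Sum>d\<in>?B. moebius d)"
    by (intro sum.union_disjoint finite_subset[OF _ fin]) auto
  also have "(\<Sum>d\<in>?B. moebius d) = (\<Sum>d\<in>?A. moebius (p * d))"
  proof (rule sum.reindex_bij_witness[of _ "\<lambda>d. p * d" "\<lambda>d. d div p"])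
    fix d assume "d \<in> ?A"
    hence "coprime p d" using p(1) by (simp add: prime_imp_coprime)
    thus "p * d \<in> ?B"
      using \<open>d \<in> ?A\<close> p by (auto simp: divides_mult power2_eq_square)
  qed (use p in \<open>auto simp: power2_eq_square elim!: dvdE\<close>)
  also have "\<dots> = (\<Sum>d\<in>?A. - moebius d)"
    using p(1) assms by (intro sum.cong moebius_prime_mult) (auto intro: Nat.gr0I)
  finally show ?thesis using False by (simp add: sum_negf)
qed (simp add: moebius_def)

text \<open>The first argument of \<open>f\<close> and \<open>a\<close> accumulates the product of
  the odd indices passed so far, which is how the shift of the subtrace is carried along. Expanding
  \<open>f\<close> and collecting terms by this product \<open>c\<close> leaves the divisor sum of
  \<open>moebius\<close> over \<open>c\<close>, so only \<open>c = 1\<close> survives.\<close>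

lemma moebius_inversion_odd:
  fixes f a :: "nat \<Rightarrow> nat \<Rightarrow> int"
  assumes f: "\<And>c m. odd c \<Longrightarrow> m > 0 \<Longrightarrow> f c m = (\<Sum>d | d dvd m \<and> odd d. a (c * d) (m div d))"
    and n: "n > 0"
  shows "(\<Sum>d | d dvd n \<and> odd d. moebius d * f d (n div d)) = a 1 n"
proof -
  let ?D = "\<lambda>m. {d :: nat. d dvd m \<and> odd d}"
  have fin: "finite {d. d dvd m}" if "m > 0" for m :: nat
    using that by simp
  have fin': "finite (?D m)" if "m > 0" for m :: nat
    by (rule finite_subset[OF _ fin[OF that]]) auto
  have pos: "n div d > 0" if "d dvd n" for d
    using that n by (auto elim!: dvdE)
  have "(\<Sum>d\<in>?D n. moebius d * f d (n div d)) =
      (\<Sum>d\<in>?D n. \<Sum>e\<in>?D (n div d). moebius d * a (d * e) (n div d div e))"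
    using pos by (intro sum.cong refl) (simp add: f sum_distrib_left)
  also have "\<dots> = (\<Sum>(d, e)\<in>Sigma (?D n) (\<lambda>d. ?D (n div d)). moebius d * a (d * e) (n div d div e))"
    using pos n by (intro sum.Sigma ballI fin') auto
  \<comment> \<open>Here \<open>c = d * e\<close>. The inner range has no parity condition because
    every divisor of an odd \<open>c\<close> is odd.\<close>
  also have "\<dots> = (\<Sum>(c, d)\<in>Sigma (?D n) (\<lambda>c. {d. d dvd c}). moebius d * a c (n div c))"
  proof (rule sum.reindex_bij_witness[of _ "\<lambda>(c, d). (d, c div d)" "\<lambda>(d, e). (d * e, d)"])
    fix x assume "x \<in> Sigma (?D n) (\<lambda>d. ?D (n div d))"
    then obtain d e where x: "x = (d, e)" "d dvd n" "odd d" "e dvd n div d" "odd e"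
      by auto
    hence "d * e dvd n" using n by (auto simp: dvd_div_iff_mult mult.commute)
    thus "(case x of (d, e) \<Rightarrow> (d * e, d)) \<in> Sigma (?D n) (\<lambda>c. {d. d dvd c})"
      using x by simp
    have "d > 0" using x(3) by (auto intro: Nat.gr0I)
    thus "(case case x of (d, e) \<Rightarrow> (d * e, d) of (c, d) \<Rightarrow> (d, c div d)) = x"
      using x by simp
    show "(case case x of (d, e) \<Rightarrow> (d * e, d) of (c, d) \<Rightarrow> moebius d * a c (n div c)) =
        (case x of (d, e) \<Rightarrow> moebius d * a (d * e) (n div d div e))"
      using x by (simp add: div_mult2_eq)
  next
    fix x assume "x \<in> Sigma (?D n) (\<lambda>c. {d. d dvd c})"
    then obtain c d where x: "x = (c, d)" "c dvd n" "odd c" "d dvd c"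
      by auto
    moreover have "d > 0" using x by (auto intro: Nat.gr0I)
    ultimately show "(case x of (c, d) \<Rightarrow> (d, c div d)) \<in> Sigma (?D n) (\<lambda>d. ?D (n div d))"
      by (auto simp: div_dvd_div dest: dvd_trans dvd_mult_div_cancel elim: dvdE)
    show "(case case x of (c, d) \<Rightarrow> (d, c div d) of (d, e) \<Rightarrow> (d * e, d)) = x"
      using x by simp
  qed
  also have "\<dots> = (\<Sum>c\<in>?D n. \<Sum>d | d dvd c. moebius d * a c (n div c))"
    by (intro sum.Sigma[symmetric] ballI fin' n fin) (use n in \<open>auto intro: Nat.gr0I\<close>)
  also have "\<dots> = (\<Sum>c\<in>?D n. if c = 1 then a c (n div c) else 0)"
  proof (intro sum.cong refl)
    fix c assume "c \<in> ?D n"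
    hence "c > 0" by (auto intro: Nat.gr0I)
    thus "(\<Sum>d | d dvd c. moebius d * a c (n div c)) = (if c = 1 then a c (n div c) else 0)"
      using sum_moebius_divisors[of c] by (simp flip: sum_distrib_right)
  qed
  also have "\<dots> = a 1 n"
    using fin'[OF n] by (subst sum.delta) auto
  finally show ?thesis .
qed

subsection \<open>Polynomials over the base field and the closure\<close>

lemma sum_lessThan_add:
  fixes f :: "nat \<Rightarrow> 'b :: comm_monoid_add"
  shows "(\<Sum>i<a + b. f i) = (\<Sum>i<a. f i) + (\<Sum>i<b. f (a + i))"
  by (induction b) (simp_all add: ac_simps)

text \<open>Stated for an arbitrary map so that it covers both the embedding \<open>to_ac\<close>
  and the Frobenius map on coefficients.\<close>

lemma map_poly_mult_hom:
  fixes f :: "'b :: comm_semiring_0 \<Rightarrow> 'c :: comm_semiring_0"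
  assumes f0: "f 0 = 0" and add: "\<And>x y. f (x + y) = f x + f y"
    and mult: "\<And>x y. f (x * y) = f x * f y"
  shows "map_poly f (p * q) = map_poly f p * map_poly f q"
proof (rule poly_eqI)
  fix n
  have sum: "f (sum g A) = (\<Sum>x\<in>A. f (g x))" for g and A :: "nat set"
    by (induction A rule: infinite_finite_induct) (auto simp: f0 add)
  show "Polynomial.coeff (map_poly f (p * q)) n = Polynomial.coeff (map_poly f p * map_poly f q) n"
    by (simp add: coeff_map_poly f0 coeff_mult sum mult)
qed

lemma linear_factors_dvd:
  fixes p :: "'b :: idom poly"
  assumes "finite A" "\<And>a. a \<in> A \<Longrightarrow> poly p a = 0"
  shows "(\<Prod>a\<in>A. [:-a, 1:]) dvd p"
  using assms
proof (induction A arbitrary: p rule: finite_induct)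
  case (insert a A)
  from insert.prems have "[:-a, 1:] dvd p"
    by (simp add: poly_eq_0_iff_dvd)
  then obtain r where r: "p = [:-a, 1:] * r" ..
  have "poly r b = 0" if "b \<in> A" for b
  proof -
    have "b \<noteq> a" using insert.hyps that by auto
    thus ?thesis using insert.prems[of b] that unfolding r by simp
  qed
  hence "(\<Prod>a\<in>A. [:-a, 1:]) dvd r" by (rule insert.IH)
  thus ?case
    unfolding r using insert.hyps by (simp add: mult_dvd_mono del: mult_pCons_left)
qed auto

lemma poly_linear_factors_eq_0_iff:
  fixes bs :: "'b :: idom list"
  shows "poly (\<Prod>b\<leftarrow>bs. [:-b, 1:]) x = 0 \<longleftrightarrow> x \<in> set bs"
  by (induction bs) auto

text \<open>Up to sign both sums are coefficients of the product. Lists too short to have such a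
  coefficient give zero sums.\<close>

lemma linear_factors_eq_imp_sums_eq:
  fixes as bs :: "'b :: idom list"
  assumes "(\<Prod>a\<leftarrow>as. [:-a, 1:]) = (\<Prod>b\<leftarrow>bs. [:-b, 1:])"
  shows "(\<Sum>i<length as. as ! i) = (\<Sum>i<length bs. bs ! i)" (is ?A)
    and "(\<Sum>j<length as. \<Sum>i<j. as ! i * as ! j) = (\<Sum>j<length bs. \<Sum>i<j. bs ! i * bs ! j)"
      (is ?B)
proof -
  have len: "length as = length bs"
    using coeff_linear_factors(1)[of as] coeff_linear_factors(1)[of bs] assms by simp
  show ?A
    using coeff_linear_factors(3)[of as] coeff_linear_factors(3)[of bs] assms len
    by (cases "length bs \<ge> 1") (simp_all add: Suc_le_eq)
  show ?B
  proof (cases "length bs \<ge> 2")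
    case True
    thus ?thesis
      using coeff_linear_factors(4)[of as] coeff_linear_factors(4)[of bs] assms len by simp
  next
    case False
    hence "length bs = 0 \<or> length bs = 1" by linarith
    thus ?thesis using len by auto
  qed
qed

lemma map_poly_to_ac_mult: "map_poly to_ac (p * q) = map_poly to_ac p * map_poly to_ac q"
  by (rule map_poly_mult_hom) auto

lemma map_poly_to_ac_add: "map_poly to_ac (p + q) = map_poly to_ac p + map_poly to_ac q"
  by (rule poly_eqI) (simp add: coeff_map_poly)

lemma degree_map_poly_to_ac: "Polynomial.degree (map_poly to_ac p) = Polynomial.degree p"
  by (intro degree_map_poly) auto

lemma map_poly_to_ac_eq_iff [simp]: "map_poly to_ac p = map_poly to_ac q \<longleftrightarrow> p = q"
  by (auto simp: poly_eq_iff coeff_map_poly)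

lemma map_poly_to_ac_eq_0_iff [simp]: "map_poly to_ac p = 0 \<longleftrightarrow> p = 0"
  using map_poly_to_ac_eq_iff[of p 0] by simp

text \<open>Division with remainder already takes place over the base field, and a nonzero remainder
  has too small a degree to become divisible in the closure.\<close>

lemma map_poly_to_ac_dvd_iff:
  fixes p q :: "'b :: field poly"
  shows "map_poly to_ac p dvd map_poly to_ac q \<longleftrightarrow> p dvd q"
proof
  assume dvd: "map_poly to_ac p dvd map_poly to_ac q"
  show "p dvd q"
  proof (cases "p = 0")
    case False
    have "map_poly to_ac q = map_poly to_ac p * map_poly to_ac (q div p) + map_poly to_ac (q mod p)"
      by (simp flip: map_poly_to_ac_mult map_poly_to_ac_add)
    with dvd have dvd': "map_poly to_ac p dvd map_poly to_ac (q mod p)"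
      by (metis dvd_add_right_iff dvd_triv_left)
    have "q mod p = 0"
    proof (rule ccontr)
      assume nz: "q mod p \<noteq> 0"
      hence "Polynomial.degree p \<le> Polynomial.degree (q mod p)"
        using dvd_imp_degree_le[OF dvd'] by (simp add: degree_map_poly_to_ac)
      thus False
        using degree_mod_less[OF False, of q] nz by simp
    qed
    thus ?thesis by auto
  qed (use dvd in auto)
qed (auto simp: dvd_def map_poly_to_ac_mult)

subsection \<open>Degree and conjugates\<close>

text \<open>For \<beta> in some \<open>GF_ext n\<close> with \<open>n > 0\<close> this is the degree
  of \<beta> over the base field, expressed as the least Frobenius period. The case
  \<open>e = 0\<close> has to be excluded since \<open>GF_ext 0\<close> is the whole
  closure.\<close>

definition ext_degree :: "'a :: finite_field alg_closure \<Rightarrow> nat" where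
  "ext_degree \<beta> = (LEAST e. e > 0 \<and> \<beta> \<in> GF_ext e)"

text \<open>The Frobenius orbit of \<beta>, ordered so that \<open>elem_trace\<close> and
  \<open>elem_subtrace\<close> at \<open>ext_degree \<beta>\<close> are the corresponding sums over
  this list.\<close>

definition conjugates :: "'a :: finite_field alg_closure \<Rightarrow> 'a alg_closure list" where
  "conjugates \<beta> = map (\<lambda>i. \<beta> ^ (CARD('a) ^ i)) [0..<ext_degree \<beta>]"

definition primitive_elems :: "nat \<Rightarrow> 'a \<Rightarrow> 'a :: finite_field \<Rightarrow> 'a alg_closure set" where
  "primitive_elems m t s = {\<beta> \<in> GF_ext m. ext_degree \<beta> = m \<and>
     elem_trace m \<beta> = to_ac t \<and> elem_subtrace m \<beta> = to_ac s}"

text \<open>The last condition says that $n$ divided by the degree of $\beta$ is odd.\<close>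

definition odd_index_elems :: "nat \<Rightarrow> 'a \<Rightarrow> 'a :: finite_field \<Rightarrow> 'a alg_closure set" where
  "odd_index_elems n t s = {\<beta> \<in> GF_ext n. elem_trace n \<beta> = to_ac t \<and> elem_subtrace n \<beta> = to_ac s \<and>
     \<not> (even n \<and> \<beta> \<in> GF_ext (n div 2))}"

text \<open>\<open>twist t d\<close> is $\binom{d}{2} t^2$ for odd $d$ in characteristic 2.\<close>

definition twist :: "'a :: comm_ring_1 \<Rightarrow> nat \<Rightarrow> 'a" where
  "twist t d = of_bool (d mod 4 = 3) * t\<^sup>2"

context
  fixes k :: nat
  assumes q: "CARD('a :: finite_field) = 2 ^ k"
begin

lemma k_pos: "k \<ge> 1"
proof (rule ccontr)
  assume "\<not> k \<ge> 1"
  hence "CARD('a) = 1" using q by simp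
  hence "(0::'a) = 1" by (metis card_1_singletonE UNIV_I singletonD)
  thus False by simp
qed

lemma char_2: "CHAR('a) = 2" "CHAR('a alg_closure) = 2"
  using CHAR_eq_2[OF q] by simp_all

lemma neg_eq: "- (x :: 'a alg_closure) = x"
  by (rule uminus_CHAR_2[OF char_2(2)])

lemma add_self: "(x :: 'a alg_closure) + x = 0"
  using neg_eq[of x] by (metis Groups.add_ac(2) ab_left_minus)

lemma frobenius_add:
  "(x + y :: 'a alg_closure) ^ (CARD('a) ^ i) = x ^ (CARD('a) ^ i) + y ^ (CARD('a) ^ i)"
  by (rule freshmans_dream'[of _ "k * i"]) (simp_all add: char_2 q power_mult)

lemma frobenius_sum:
  "(\<Sum>j\<in>A. f j :: 'a alg_closure) ^ (CARD('a) ^ i) = (\<Sum>j\<in>A. f j ^ (CARD('a) ^ i))"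
  by (rule freshmans_dream_sum'[of _ "k * i"]) (simp_all add: char_2 q power_mult)

text \<open>Powers of Frobenius are additive with trivial kernel, and in characteristic 2 the
  difference of \<open>x\<close> and \<open>y\<close> is their sum.\<close>

lemma frobenius_inj:
  assumes "(x :: 'a alg_closure) ^ (CARD('a) ^ i) = y ^ (CARD('a) ^ i)"
  shows "x = y"
proof -
  have "(x + y) ^ (CARD('a) ^ i) = 0"
    using assms by (simp add: frobenius_add add_self)
  hence "x + y = 0" by simp
  thus ?thesis by (simp add: add_eq_0_iff2 neg_eq)
qed

lemma frobenius_frobenius:
  "((x :: 'a alg_closure) ^ (CARD('a) ^ i)) ^ (CARD('a) ^ j) = x ^ (CARD('a) ^ (i + j))"
  by (simp add: power_add power_mult)

lemma GF_ext_add_iff: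
  assumes "(\<beta> :: 'a alg_closure) \<in> GF_ext m"
  shows "\<beta> \<in> GF_ext (m + n) \<longleftrightarrow> \<beta> \<in> GF_ext n"
  using assms by (simp add: GF_ext_def flip: frobenius_frobenius)

lemma frobenius_add_period:
  assumes "(\<beta> :: 'a alg_closure) \<in> GF_ext m"
  shows "\<beta> ^ (CARD('a) ^ (m + n)) = \<beta> ^ (CARD('a) ^ n)"
  using assms by (simp add: GF_ext_def flip: frobenius_frobenius)

lemma GF_ext_mult:
  assumes "(\<beta> :: 'a alg_closure) \<in> GF_ext m"
  shows "\<beta> \<in> GF_ext (d * m)"
  by (induction d) (use assms GF_ext_add_iff in \<open>auto simp: GF_ext_def\<close>)

lemma ext_degree:
  assumes "(\<beta> :: 'a alg_closure) \<in> GF_ext n" "n > 0"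
  shows "ext_degree \<beta> > 0" "\<beta> \<in> GF_ext (ext_degree \<beta>)"
  using LeastI[of "\<lambda>e. e > 0 \<and> \<beta> \<in> GF_ext e" n] assms unfolding ext_degree_def by auto

text \<open>The Frobenius periods of \<beta> are the multiples of the least positive one: the
  remainder of a period modulo the least one is again a period.\<close>

lemma GF_ext_iff_ext_degree_dvd:
  assumes "(\<beta> :: 'a alg_closure) \<in> GF_ext n" "n > 0"
  shows "\<beta> \<in> GF_ext m \<longleftrightarrow> ext_degree \<beta> dvd m"
proof
  note e = ext_degree[OF assms]
  assume "\<beta> \<in> GF_ext m"
  also have "m = (m div ext_degree \<beta>) * ext_degree \<beta> + m mod ext_degree \<beta>"
    by simp
  finally have "\<beta> \<in> GF_ext (m mod ext_degree \<beta>)"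
    using GF_ext_add_iff[OF GF_ext_mult[OF e(2)]] by blast
  moreover have "m mod ext_degree \<beta> < ext_degree \<beta>" using e by simp
  ultimately have "m mod ext_degree \<beta> = 0"
    using not_less_Least[of "m mod ext_degree \<beta>" "\<lambda>e. e > 0 \<and> \<beta> \<in> GF_ext e"]
    unfolding ext_degree_def[symmetric] by simp
  thus "ext_degree \<beta> dvd m" by auto
next
  assume "ext_degree \<beta> dvd m"
  then obtain d where "m = d * ext_degree \<beta>" by (metis dvdE mult.commute)
  thus "\<beta> \<in> GF_ext m"
    using GF_ext_mult[OF ext_degree(2)[OF assms]] by simp
qed

text \<open>An inclusion between sets of equal cardinality. It provides the descent used below:
  whatever Frobenius fixes comes from the base field.\<close>

lemma GF_ext_1: "GF_ext 1 = range (to_ac :: 'a \<Rightarrow> _)"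
proof (rule sym, rule card_subset_eq)
  show "finite (GF_ext 1 :: 'a alg_closure set)"
    by (rule finite_GF_ext_card[OF q k_pos]) simp
  show "range (to_ac :: 'a \<Rightarrow> _) \<subseteq> GF_ext 1"
    using GF_ext_subfield(1)[OF q] by blast
  show "card (range (to_ac :: 'a \<Rightarrow> _)) = card (GF_ext 1 :: 'a alg_closure set)"
    by (subst finite_GF_ext_card(2)[OF q k_pos]) (simp_all add: card_image inj_to_ac)
qed

lemma frobenius_fixed_imp_range:
  assumes "(x :: 'a alg_closure) ^ CARD('a) = x"
  shows "x \<in> range to_ac"
  using assms unfolding GF_ext_1[symmetric] by (simp add: GF_ext_def)

subsection \<open>Minimal polynomials\<close>

text \<open>If two conjugates agree, injectivity of Frobenius cancels the smaller exponent and
  leaves a positive period below the least one.\<close>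

lemma conjugates_distinct:
  assumes "(\<beta> :: 'a alg_closure) \<in> GF_ext n" "n > 0"
  shows "distinct (conjugates \<beta>)"
proof -
  have less: "\<beta> ^ (CARD('a) ^ i) \<noteq> \<beta> ^ (CARD('a) ^ j)" if "i < j" "j < ext_degree \<beta>" for i j
  proof
    assume "\<beta> ^ (CARD('a) ^ i) = \<beta> ^ (CARD('a) ^ j)"
    also have "\<dots> = (\<beta> ^ (CARD('a) ^ (j - i))) ^ (CARD('a) ^ i)"
      using that by (simp add: frobenius_frobenius)
    finally have "\<beta> \<in> GF_ext (j - i)"
      using frobenius_inj unfolding GF_ext_def by fastforce
    hence "ext_degree \<beta> dvd j - i"
      using GF_ext_iff_ext_degree_dvd[OF assms] by blast
    thus False using that by (auto dest: dvd_imp_le)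
  qed
  hence "inj_on (\<lambda>i. \<beta> ^ (CARD('a) ^ i)) {0..<ext_degree \<beta>}"
    by (intro inj_onI) (metis atLeastLessThan_iff linorder_neqE_nat)
  thus ?thesis by (simp add: conjugates_def distinct_map)
qed

text \<open>Frobenius on the coefficients permutes the linear factors cyclically, so it fixes every
  coefficient of the product.\<close>

lemma conjugates_poly_in_base_field:
  assumes "(\<beta> :: 'a alg_closure) \<in> GF_ext n" "n > 0"
  obtains p :: "'a poly" where "map_poly to_ac p = (\<Prod>b\<leftarrow>conjugates \<beta>. [:-b, 1:])"
proof -
  define e where "e = ext_degree \<beta>"
  note e = ext_degree[OF assms, folded e_def]
  define m where "m = (\<Prod>i<e. [:-(\<beta> ^ (CARD('a) ^ i)), 1:])"
  have m: "(\<Prod>b\<leftarrow>conjugates \<beta>. [:-b, 1:]) = m"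
    unfolding m_def conjugates_def e_def
    by (simp add: o_def interv_sum_list_conv_sum_set_nat atLeast0LessThan flip: prod.distinct_set_conv_list)
  let ?\<phi> = "\<lambda>x :: 'a alg_closure. x ^ CARD('a)"
  have card: "CARD('a) > 0" by simp
  have mult: "map_poly ?\<phi> (p * r) = map_poly ?\<phi> p * map_poly ?\<phi> r" for p r
    using frobenius_add[of _ _ 1] by (intro map_poly_mult_hom) (auto simp: power_mult_distrib)
  have lin: "map_poly ?\<phi> [:-b, 1:] = [:-(b ^ CARD('a)), 1:]" for b
    by (simp add: map_poly_pCons card neg_eq)
  have "map_poly ?\<phi> (\<Prod>i<r. [:-(\<beta> ^ (CARD('a) ^ i)), 1:]) = (\<Prod>i<r. [:-(\<beta> ^ (CARD('a) ^ Suc i)), 1:])" for r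
  proof (induction r)
    case (Suc r)
    have pow: "(\<beta> ^ (CARD('a) ^ r)) ^ CARD('a) = \<beta> ^ (CARD('a) ^ Suc r)"
      by (simp only: power_Suc2 power_mult)
    show ?case
      by (simp only: prod.lessThan_Suc mult Suc.IH lin pow)
  qed simp
  hence "map_poly ?\<phi> m = (\<Prod>i<e. [:-(\<beta> ^ (CARD('a) ^ Suc i)), 1:])"
    by (simp add: m_def)
  also have "\<dots> = m"
  proof -
    obtain r where r: "e = Suc r" using e(1) gr0_conv_Suc by blast
    \<comment> \<open>The last shifted factor wraps around to the first original one.\<close>
    have "\<beta> ^ (CARD('a) ^ Suc r) = \<beta> ^ (CARD('a) ^ 0)"
      using e(2) by (simp add: r GF_ext_def)
    thus ?thesis
      unfolding m_def r prod.lessThan_Suc[of _ r]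
        prod.lessThan_Suc_shift[of "\<lambda>i. [:-(\<beta> ^ (CARD('a) ^ i)), 1:]"]
      by (simp only: mult.commute)
  qed
  finally have fixed: "map_poly ?\<phi> m = m" .
  have "Polynomial.coeff m i ^ CARD('a) = Polynomial.coeff (map_poly ?\<phi> m) i" for i
    by (subst coeff_map_poly) (simp_all add: card)
  hence "Polynomial.coeff m i ^ CARD('a) = Polynomial.coeff m i" for i
    by (simp only: fixed)
  hence range: "Polynomial.coeff m i \<in> range to_ac" for i
    by (rule frobenius_fixed_imp_range)
  have "map_poly to_ac (map_poly of_ac m) = m"
    by (rule poly_eqI) (simp add: coeff_map_poly to_ac_of_ac[OF range])
  thus ?thesis using that m by metis
qed

text \<open>Frobenius is a ring homomorphism fixing the coefficients of \<open>p\<close>, so it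
  commutes with evaluation.\<close>

lemma poly_frobenius:
  fixes p :: "'a poly"
  assumes "poly (map_poly to_ac p) \<beta> = 0"
  shows "poly (map_poly to_ac p) (\<beta> ^ (CARD('a) ^ i)) = 0"
proof -
  have c: "to_ac (x :: 'a) ^ (CARD('a) ^ i) = to_ac x" for x
    using GF_ext_subfield(1)[OF q, of x i] by (simp add: GF_ext_def)
  have "poly (map_poly to_ac p) (\<beta> ^ (CARD('a) ^ i)) = poly (map_poly to_ac p) \<beta> ^ (CARD('a) ^ i)"
    by (simp add: poly_altdef frobenius_sum power_mult_distrib coeff_map_poly c power_commutes flip: power_mult)
       (simp add: mult.commute)
  thus ?thesis by (simp add: assms)
qed

text \<open>The Frobenius orbit of a root consists of roots, hence is finite. A repetition in it
  gives a period.\<close>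

lemma root_in_GF_ext:
  fixes p :: "'a poly"
  assumes "p \<noteq> 0" "poly (map_poly to_ac p) \<beta> = 0"
  obtains n where "n > 0" "\<beta> \<in> GF_ext n"
proof -
  have "range (\<lambda>i. \<beta> ^ (CARD('a) ^ i)) \<subseteq> {x. poly (map_poly to_ac p) x = 0}"
    using poly_frobenius[OF assms(2)] by blast
  moreover have "finite {x. poly (map_poly to_ac p) x = 0}"
    by (rule poly_roots_finite) (use assms in auto)
  ultimately have "finite (range (\<lambda>i. \<beta> ^ (CARD('a) ^ i)))"
    by (rule finite_subset)
  hence "\<not> inj (\<lambda>i. \<beta> ^ (CARD('a) ^ i))"
    using finite_imageD by blast
  then obtain i j where ij: "i < j" "\<beta> ^ (CARD('a) ^ i) = \<beta> ^ (CARD('a) ^ j)"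
    unfolding inj_on_def by (metis linorder_neqE_nat)
  have "\<beta> ^ (CARD('a) ^ i) = (\<beta> ^ (CARD('a) ^ (j - i))) ^ (CARD('a) ^ i)"
    using ij by (simp add: frobenius_frobenius)
  hence "\<beta> \<in> GF_ext (j - i)"
    using frobenius_inj unfolding GF_ext_def by fastforce
  thus ?thesis using that ij(1) by (metis zero_less_diff)
qed

text \<open>A polynomial over the base field vanishing at \<beta> vanishes at all its conjugates.
  These are distinct, so the whole product divides it, and divisibility descends to the base
  field.\<close>

lemma minimal_polynomial_dvd:
  fixes m p :: "'a poly"
  assumes "\<beta> \<in> GF_ext n" "n > 0"
    and m: "map_poly to_ac m = (\<Prod>b\<leftarrow>conjugates \<beta>. [:-b, 1:])"
  shows "m dvd p \<longleftrightarrow> poly (map_poly to_ac p) \<beta> = 0"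
proof
  assume "poly (map_poly to_ac p) \<beta> = 0"
  hence "(\<Prod>b\<in>set (conjugates \<beta>). [:-b, 1:]) dvd map_poly to_ac p"
    using poly_frobenius by (intro linear_factors_dvd) (auto simp: conjugates_def)
  thus "m dvd p"
    unfolding map_poly_to_ac_dvd_iff[of m, symmetric] m
      prod.distinct_set_conv_list[OF conjugates_distinct[OF assms(1,2)]] .
next
  assume "m dvd p"
  have "\<beta> \<in> set (conjugates \<beta>)"
    using ext_degree(1)[OF assms(1,2)] unfolding conjugates_def by force
  hence "[:-\<beta>, 1:] dvd map_poly to_ac m"
    unfolding m by (intro prod_list_dvd) auto
  hence "[:-\<beta>, 1:] dvd map_poly to_ac p"
    using \<open>m dvd p\<close> map_poly_to_ac_dvd_iff dvd_trans by metis
  thus "poly (map_poly to_ac p) \<beta> = 0"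
    by (simp add: poly_eq_0_iff_dvd)
qed

text \<open>Divisibility by \<open>m\<close> is vanishing at \<beta>, and a product vanishes there
  only if a factor does; hence \<open>m\<close> is prime.\<close>

lemma minimal_polynomial_irreducible:
  fixes m :: "'a poly"
  assumes "\<beta> \<in> GF_ext n" "n > 0"
    and m: "map_poly to_ac m = (\<Prod>b\<leftarrow>conjugates \<beta>. [:-b, 1:])"
  shows "Factorial_Ring.irreducible m" "Polynomial.lead_coeff m = 1"
    "Polynomial.degree m = ext_degree \<beta>"
proof -
  have len: "length (conjugates \<beta>) = ext_degree \<beta>"
    by (simp add: conjugates_def)
  show deg: "Polynomial.degree m = ext_degree \<beta>"
    using coeff_linear_factors(1)[of "conjugates \<beta>"] len degree_map_poly_to_ac[of m] by (simp add: m)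
  have "to_ac (Polynomial.lead_coeff m) = 1"
    using coeff_linear_factors(2)[of "conjugates \<beta>"] len deg
    by (simp add: coeff_map_poly flip: m)
  thus lc: "Polynomial.lead_coeff m = 1"
    by (metis to_ac_1 to_ac_eq_iff)
  have "m \<noteq> 0" using lc by auto
  moreover from this have "\<not> is_unit m"
    using deg ext_degree(1)[OF assms(1,2)] by (simp add: is_unit_iff_degree)
  ultimately have "prime_elem m"
    by (intro prime_elemI)
       (simp_all add: minimal_polynomial_dvd[OF assms] map_poly_to_ac_mult)
  thus "Factorial_Ring.irreducible m"
    by (rule prime_elem_imp_irreducible)
qed

text \<open>The minimal polynomial of the root divides \<open>p\<close>. Irreducibility makes the
  cofactor a unit, and both polynomials being monic makes it 1.\<close>

lemma irreducible_eq_minimal_polynomial: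
  fixes p :: "'a poly"
  assumes "Factorial_Ring.irreducible p" "Polynomial.lead_coeff p = 1"
    "poly (map_poly to_ac p) \<beta> = 0"
  shows "\<beta> \<in> GF_ext (Polynomial.degree p)" "Polynomial.degree p > 0"
    "map_poly to_ac p = (\<Prod>b\<leftarrow>conjugates \<beta>. [:-b, 1:])"
proof -
  obtain n where n: "n > 0" "\<beta> \<in> GF_ext n"
    by (rule root_in_GF_ext[OF _ assms(3)]) (use assms(2) in auto)
  obtain m :: "'a poly" where m: "map_poly to_ac m = (\<Prod>b\<leftarrow>conjugates \<beta>. [:-b, 1:])"
    using conjugates_poly_in_base_field n by blast
  note min = minimal_polynomial_irreducible[OF n(2,1) m]
  have "m dvd p"
    using minimal_polynomial_dvd[OF n(2,1) m] assms(3) by blast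
  then obtain c where c: "p = m * c" ..
  hence "is_unit c"
    using Factorial_Ring.irreducibleD[OF assms(1) c] min(1) Factorial_Ring.irreducible_not_unit by blast
  moreover have "c \<noteq> 0" using assms(2) c by auto
  ultimately have "Polynomial.degree c = 0" using is_unit_iff_degree by blast
  moreover have "Polynomial.lead_coeff c = 1"
    using assms(2) min(2) unfolding c by (simp add: lead_coeff_mult)
  ultimately have "c = 1"
    by (metis degree_0_id of_nat_1 of_nat_poly lead_coeff_pCons(2) degree_eq_zeroE one_pCons)
  hence pm: "p = m" using c by simp
  show "map_poly to_ac p = (\<Prod>b\<leftarrow>conjugates \<beta>. [:-b, 1:])" "\<beta> \<in> GF_ext (Polynomial.degree p)"
    "Polynomial.degree p > 0"
    using m min ext_degree[OF n(2,1)] by (simp_all add: pm)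
qed

lemma poly_trace_eq_elem_trace:
  fixes p :: "'a poly"
  assumes "Factorial_Ring.irreducible p" "Polynomial.lead_coeff p = 1"
    "poly (map_poly to_ac p) \<beta> = 0"
  shows "poly_trace p = elem_trace (Polynomial.degree p) \<beta>"
    and "poly_subtrace p = elem_subtrace (Polynomial.degree p) \<beta>"
    and "ext_degree \<beta> = Polynomial.degree p"
proof -
  note min = irreducible_eq_minimal_polynomial[OF assms]
  show deg: "ext_degree \<beta> = Polynomial.degree p"
    using minimal_polynomial_irreducible(3)[OF min] by simp
  have eq: "(\<Prod>b\<leftarrow>poly_root_list p. [:-b, 1:]) = (\<Prod>b\<leftarrow>conjugates \<beta>. [:-b, 1:])"
    using min(3) poly_root_list_splits(1)[OF assms(2)] by simp
  have len: "length (conjugates \<beta>) = Polynomial.degree p"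
    by (simp add: conjugates_def deg)
  have nth: "conjugates \<beta> ! i = \<beta> ^ (CARD('a) ^ i)" if "i < Polynomial.degree p" for i
    using that by (simp add: conjugates_def deg)
  show "poly_trace p = elem_trace (Polynomial.degree p) \<beta>"
    unfolding poly_trace_def Let_def linear_factors_eq_imp_sums_eq(1)[OF eq] len elem_trace_def
    by (intro sum.cong refl) (simp add: nth)
  show "poly_subtrace p = elem_subtrace (Polynomial.degree p) \<beta>"
    unfolding poly_subtrace_def Let_def linear_factors_eq_imp_sums_eq(2)[OF eq] len elem_subtrace_def
    by (intro sum.cong refl) (simp add: nth)
qed

text \<open>Every polynomial counted by \<open>P m t s\<close> has \<open>m\<close> distinct roots,
  and a root determines its polynomial, so the root sets partition
  \<open>primitive_elems m t s\<close>.\<close>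

lemma card_primitive_elems:
  assumes "m > 0"
  shows "card (primitive_elems m t s) = m * P m t (s :: 'a)"
proof -
  define S where "S = {p :: 'a poly. Polynomial.lead_coeff p = 1 \<and> Factorial_Ring.irreducible p \<and>
     Polynomial.degree p = m \<and> poly_trace p = to_ac t \<and> poly_subtrace p = to_ac s}"
  define R where "R = (\<lambda>p :: 'a poly. {\<beta>. poly (map_poly to_ac p) \<beta> = 0})"
  have fin_R: "finite (R p)" if "p \<in> S" for p
    unfolding R_def by (rule poly_roots_finite) (use that in \<open>auto simp: S_def\<close>)
  have root: "\<exists>\<beta>. \<beta> \<in> R p" if "p \<in> S" for p
    using alg_closed_imp_poly_has_root[of "map_poly to_ac p"] that assms
    by (simp add: S_def R_def degree_map_poly_to_ac)
  have card_R: "card (R p) = m" if p: "p \<in> S" for p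
  proof -
    obtain \<beta> where \<beta>: "\<beta> \<in> R p" using root[OF p] by blast
    have irr: "Factorial_Ring.irreducible p" "Polynomial.lead_coeff p = 1"
        "poly (map_poly to_ac p) \<beta> = 0"
      using p \<beta> by (auto simp: S_def R_def)
    note min = irreducible_eq_minimal_polynomial[OF irr]
    have "R p = set (conjugates \<beta>)"
      by (auto simp: R_def min(3) poly_linear_factors_eq_0_iff)
    thus ?thesis
      using distinct_card[OF conjugates_distinct[OF min(1,2)]] poly_trace_eq_elem_trace(3)[OF irr] p
      by (simp add: conjugates_def S_def)
  qed
  have eqI: "p = r" if "p \<in> S" "r \<in> S" "\<beta> \<in> R p" "\<beta> \<in> R r" for p r \<beta>
  proof -
    have "map_poly to_ac u = (\<Prod>b\<leftarrow>conjugates \<beta>. [:-b, 1:])" if "u \<in> S" "\<beta> \<in> R u" for u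
      by (rule irreducible_eq_minimal_polynomial(3)) (use that in \<open>auto simp: S_def R_def\<close>)
    from this[of p] this[of r] have "map_poly to_ac p = map_poly to_ac r"
      using that by simp
    thus ?thesis by simp
  qed
  have union: "primitive_elems m t s = (\<Union>p\<in>S. R p)"
  proof (intro equalityI subsetI)
    fix \<beta> assume "\<beta> \<in> primitive_elems m t s"
    hence \<beta>: "\<beta> \<in> GF_ext m" "ext_degree \<beta> = m" "elem_trace m \<beta> = to_ac t"
        "elem_subtrace m \<beta> = to_ac s"
      by (auto simp: primitive_elems_def)
    obtain p :: "'a poly" where p: "map_poly to_ac p = (\<Prod>b\<leftarrow>conjugates \<beta>. [:-b, 1:])"
      using conjugates_poly_in_base_field[OF \<beta>(1) assms] by blast
    note irr = minimal_polynomial_irreducible[OF \<beta>(1) assms p]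
    have "poly (map_poly to_ac p) \<beta> = 0"
      using minimal_polynomial_dvd[OF \<beta>(1) assms p, of p] by simp
    moreover from this have "p \<in> S"
      using irr \<beta> poly_trace_eq_elem_trace(1,2)[OF irr(1,2)] by (simp add: S_def)
    ultimately show "\<beta> \<in> (\<Union>p\<in>S. R p)" by (auto simp: R_def)
  next
    fix \<beta> assume "\<beta> \<in> (\<Union>p\<in>S. R p)"
    then obtain p where p: "p \<in> S" "\<beta> \<in> R p" by blast
    hence irr: "Factorial_Ring.irreducible p" "Polynomial.lead_coeff p = 1"
        "poly (map_poly to_ac p) \<beta> = 0"
      by (auto simp: S_def R_def)
    show "\<beta> \<in> primitive_elems m t s"
      using p(1) irreducible_eq_minimal_polynomial(1)[OF irr] poly_trace_eq_elem_trace[OF irr]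
      by (auto simp: primitive_elems_def S_def)
  qed
  have "finite (GF_ext m :: 'a alg_closure set)"
    using finite_GF_ext_card[OF q k_pos] assms by simp
  hence "finite (primitive_elems m t s)"
    by (rule finite_subset[rotated]) (auto simp: primitive_elems_def)
  \<comment> \<open>Finiteness of the set of polynomials is inherited from the finite union of their
    root sets, as \<open>R\<close> is injective on \<open>S\<close>.\<close>
  hence "finite (R ` S)"
    unfolding union by (rule finite_UnionD)
  moreover have "inj_on R S"
    using eqI root by (intro inj_onI) blast
  ultimately have fin: "finite S" by (rule finite_imageD)
  have "card (primitive_elems m t s) = (\<Sum>p\<in>S. card (R p))"
    unfolding union by (intro card_UN_disjoint fin ballI fin_R impI) (use eqI in blast)+
  also have "\<dots> = m * card S" by (simp add: card_R)
  finally show ?thesis by (simp add: P_def S_def)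
qed

subsection \<open>Traces and subtraces relative to subfields\<close>

lemma elem_trace_add:
  assumes "(\<beta> :: 'a alg_closure) \<in> GF_ext a"
  shows "elem_trace (a + b) \<beta> = elem_trace a \<beta> + elem_trace b \<beta>"
  by (simp add: elem_trace_def sum_lessThan_add frobenius_add_period[OF assms])

text \<open>After the first \<open>a\<close> powers the Frobenius sequence starts again. The pairs
  lie within the first block, across the two blocks, or within the second.\<close>

lemma elem_subtrace_add:
  assumes "(\<beta> :: 'a alg_closure) \<in> GF_ext a"
  shows "elem_subtrace (a + b) \<beta> =
    elem_subtrace a \<beta> + elem_trace a \<beta> * elem_trace b \<beta> + elem_subtrace b \<beta>"
proof -
  let ?x = "\<lambda>i. \<beta> ^ (CARD('a) ^ i)"
  have "(\<Sum>i<a + j. ?x i * ?x (a + j)) = elem_trace a \<beta> * ?x j + (\<Sum>i<j. ?x i * ?x j)" for j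
    by (simp add: elem_trace_def sum_lessThan_add frobenius_add_period[OF assms] sum_distrib_right)
  thus ?thesis
    by (simp add: elem_subtrace_def sum_lessThan_add sum.distrib elem_trace_def add.assoc
        flip: sum_distrib_left)
qed

text \<open>With two equal blocks everything cancels in characteristic 2 except the cross term of
  the subtrace.\<close>

lemma elem_trace_double:
  assumes "(\<beta> :: 'a alg_closure) \<in> GF_ext m"
  shows "elem_trace (2 * m) \<beta> = 0" "elem_subtrace (2 * m) \<beta> = (elem_trace m \<beta>)\<^sup>2"
proof -
  show "elem_trace (2 * m) \<beta> = 0"
    by (simp add: mult_2 elem_trace_add[OF assms] add_self)
  have "elem_subtrace (2 * m) \<beta> = (elem_subtrace m \<beta> + elem_subtrace m \<beta>) + (elem_trace m \<beta>)\<^sup>2"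
    unfolding mult_2 elem_subtrace_add[OF assms] by (simp add: power2_eq_square)
  thus "elem_subtrace (2 * m) \<beta> = (elem_trace m \<beta>)\<^sup>2"
    by (simp add: add_self)
qed

text \<open>The blocks are added two at a time. Such a pair has trace 0, hence no cross term with
  the rest, and adds one squared trace to the subtrace; only the parity of the number of pairs
  matters.\<close>

lemma elem_trace_odd_mult:
  assumes "(\<beta> :: 'a alg_closure) \<in> GF_ext m" "odd d"
  shows "elem_trace (d * m) \<beta> = elem_trace m \<beta>"
    and "elem_subtrace (d * m) \<beta> = elem_subtrace m \<beta> + of_bool (d mod 4 = 3) * (elem_trace m \<beta>)\<^sup>2"
proof -
  obtain e where d: "d = 2 * e + 1" using assms(2) by (rule oddE)
  have "elem_trace ((2 * e + 1) * m) \<beta> = elem_trace m \<beta> \<and>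
    elem_subtrace ((2 * e + 1) * m) \<beta> = elem_subtrace m \<beta> + of_bool (odd e) * (elem_trace m \<beta>)\<^sup>2"
  proof (induction e)
    case (Suc e)
    have split: "(2 * Suc e + 1) * m = 2 * m + (2 * e + 1) * m" by (simp add: algebra_simps)
    have "\<beta> \<in> GF_ext (2 * m)" by (rule GF_ext_mult[OF assms(1)])
    note add = elem_trace_add[OF this] elem_subtrace_add[OF this]
    have "elem_trace ((2 * Suc e + 1) * m) \<beta> = elem_trace m \<beta>"
      unfolding split add using Suc.IH by (simp only: elem_trace_double[OF assms(1)] add_0)
    moreover have "elem_subtrace ((2 * Suc e + 1) * m) \<beta> =
        elem_subtrace m \<beta> + of_bool (odd (Suc e)) * (elem_trace m \<beta>)\<^sup>2"
      unfolding split add elem_trace_double[OF assms(1)] Suc.IH[THEN conjunct2]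
      using add_self[of "(elem_trace m \<beta>)\<^sup>2"] by (auto simp: algebra_simps)
    ultimately show ?case by blast
  qed simp
  moreover have "odd e \<longleftrightarrow> d mod 4 = 3" unfolding d by presburger
  ultimately show "elem_trace (d * m) \<beta> = elem_trace m \<beta>"
    and "elem_subtrace (d * m) \<beta> = elem_subtrace m \<beta> + of_bool (d mod 4 = 3) * (elem_trace m \<beta>)\<^sup>2"
    unfolding d by simp_all
qed

subsection \<open>Fibres of the squared trace\<close>

text \<open>Frobenius permutes the summands of the trace cyclically, so it fixes the trace.\<close>

lemma elem_trace_in_range:
  assumes "(\<beta> :: 'a alg_closure) \<in> GF_ext m"
  shows "elem_trace m \<beta> \<in> range to_ac"
proof (rule frobenius_fixed_imp_range)
  have "elem_trace m \<beta> ^ CARD('a) = (\<Sum>i<m. \<beta> ^ (CARD('a) ^ Suc i))"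
    using frobenius_sum[of "\<lambda>i. \<beta> ^ (CARD('a) ^ i)" "{..<m}" 1]
    by (simp add: elem_trace_def mult.commute flip: power_mult)
  moreover have "\<beta> ^ (CARD('a) ^ m) = \<beta> ^ (CARD('a) ^ 0)"
    using assms by (simp add: GF_ext_def)
  hence "(\<Sum>i<m. \<beta> ^ (CARD('a) ^ Suc i)) = elem_trace m \<beta>"
    unfolding elem_trace_def using sum.lessThan_Suc[of "\<lambda>i. \<beta> ^ (CARD('a) ^ i)" m]
      sum.lessThan_Suc_shift[of "\<lambda>i. \<beta> ^ (CARD('a) ^ i)" m] by (metis add.commute add_left_cancel)
  ultimately show "elem_trace m \<beta> ^ CARD('a) = elem_trace m \<beta>" by simp
qed

text \<open>The fibre is the root set of a nonzero polynomial of degree at most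
  \<open>CARD('a) ^ (m - 1)\<close>.\<close>

lemma card_elem_trace_fibre_le:
  assumes "m > 0"
  shows "finite {\<beta> :: 'a alg_closure. elem_trace m \<beta> = w}"
    and "card {\<beta> :: 'a alg_closure. elem_trace m \<beta> = w} \<le> CARD('a) ^ (m - 1)"
proof -
  let ?q = "CARD('a)"
  have q1: "?q > 1" unfolding q using k_pos by (intro one_less_power) auto
  define f :: "'a alg_closure poly" where "f = (\<Sum>i<m. Polynomial.monom 1 (?q ^ i)) - [:w:]"
  have "Polynomial.coeff f (?q ^ (m - 1)) = (\<Sum>i<m. if i = m - 1 then 1 else 0)"
    unfolding f_def coeff_diff coeff_sum using q1
    by (simp add: coeff_pCons coeff_monom power_inject_exp split: nat.splits)
  also have "\<dots> = 1" using assms by simp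
  finally have "f \<noteq> 0" by auto
  moreover have "Polynomial.degree f \<le> ?q ^ (m - 1)"
    unfolding f_def
  proof (intro degree_diff_le degree_sum_le)
    fix i assume "i \<in> {..<m}"
    hence "?q ^ i \<le> ?q ^ (m - 1)" using q1 by (intro power_increasing) auto
    thus "Polynomial.degree (Polynomial.monom 1 (?q ^ i)) \<le> ?q ^ (m - 1)"
      using degree_monom_le order_trans by blast
  qed auto
  moreover have "{\<beta>. elem_trace m \<beta> = w} = {\<beta>. poly f \<beta> = 0}"
    by (auto simp: f_def elem_trace_def poly_sum poly_monom)
  ultimately show "finite {\<beta> :: 'a alg_closure. elem_trace m \<beta> = w}"
    and "card {\<beta> :: 'a alg_closure. elem_trace m \<beta> = w} \<le> ?q ^ (m - 1)"
    using poly_roots_finite[of f] card_poly_roots_bound[of f] by auto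
qed

text \<open>The $q$ fibres have at most $q^{m-1}$ elements each and together $q^m$.\<close>

lemma card_elem_trace_squared:
  assumes "m > 0"
  shows "card {\<beta> \<in> GF_ext m. (elem_trace m \<beta>)\<^sup>2 = to_ac (s :: 'a)} = CARD('a) ^ (m - 1)"
proof -
  let ?N = "\<lambda>c :: 'a. {\<beta> \<in> GF_ext m. (elem_trace m \<beta>)\<^sup>2 = to_ac c}"
  have fin: "finite (GF_ext m :: 'a alg_closure set)"
    using finite_GF_ext_card[OF q k_pos] assms by simp
  have le: "card (?N c) \<le> CARD('a) ^ (m - 1)" for c
  proof -
    \<comment> \<open>Square roots are unique in characteristic 2, so fixing the square of the trace
      fixes the trace.\<close>
    have "?N c \<subseteq> {\<beta>. elem_trace m \<beta> = w}" if w: "w\<^sup>2 = to_ac c" for w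
      using w by (auto simp: power2_eq_iff neg_eq simp flip: w)
    moreover obtain w where "w\<^sup>2 = to_ac c"
      using nth_root_exists[of 2 "to_ac c"] by auto
    ultimately show ?thesis
      using card_mono[OF card_elem_trace_fibre_le(1)[OF assms]] card_elem_trace_fibre_le(2)[OF assms]
      by (meson le_trans)
  qed
  have "(\<Union>c. ?N c) = GF_ext m"
  proof (intro equalityI subsetI)
    fix \<beta> :: "'a alg_closure" assume "\<beta> \<in> GF_ext m"
    moreover from elem_trace_in_range[OF this] obtain c where "elem_trace m \<beta> = to_ac c" by blast
    hence "(elem_trace m \<beta>)\<^sup>2 = to_ac (c\<^sup>2)" by simp
    ultimately show "\<beta> \<in> (\<Union>c. ?N c)" by blast
  qed auto
  hence "card (GF_ext m :: 'a alg_closure set) = (\<Sum>c\<in>UNIV. card (?N c))"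
    using card_UN_disjoint[of UNIV ?N] finite_subset[OF _ fin] by fastforce
  moreover have "card (GF_ext m :: 'a alg_closure set) = CARD('a) ^ m"
    using finite_GF_ext_card[OF q k_pos] assms by simp
  moreover have "CARD('a) ^ m = (\<Sum>c\<in>(UNIV :: 'a set). CARD('a) ^ (m - 1))"
    using assms by (simp add: power_eq_if)
  ultimately have sum: "(\<Sum>c\<in>UNIV. card (?N c)) = (\<Sum>c\<in>(UNIV :: 'a set). CARD('a) ^ (m - 1))"
    by simp
  show ?thesis
  proof (rule ccontr)
    assume "card (?N s) \<noteq> CARD('a) ^ (m - 1)"
    hence "card (?N s) < CARD('a) ^ (m - 1)" using le[of s] by simp
    hence "(\<Sum>c\<in>UNIV. card (?N c)) < (\<Sum>c\<in>(UNIV :: 'a set). CARD('a) ^ (m - 1))"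
      using le by (intro sum_strict_mono_ex1) auto
    thus False using sum by simp
  qed
qed

subsection \<open>Counting by degree\<close>

text \<open>An element of degree \<open>e\<close> with \<open>n = d * e\<close> belongs to the part
  of index \<open>d\<close>, and \<open>elem_trace_odd_mult\<close> translates its trace and
  subtrace from level \<open>n\<close> to level \<open>e\<close>.\<close>

lemma odd_index_elems_eq_UN:
  assumes n: "n > 0"
  shows "odd_index_elems n t s =
    (\<Union>d\<in>{d. d dvd n \<and> odd d}. primitive_elems (n div d) t (s + twist t d :: 'a))"
proof -
  have *: "elem_trace n \<beta> = to_ac t \<and> elem_subtrace n \<beta> = to_ac s \<longleftrightarrow>
      elem_trace e \<beta> = to_ac t \<and> elem_subtrace e \<beta> = to_ac (s + twist t d)"
    if "\<beta> \<in> GF_ext e" "n = d * e" "odd d" for \<beta> d e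
  proof -
    \<comment> \<open>In characteristic 2 the shift of the subtrace can change sides without a
      sign.\<close>
    have "x + y = z \<longleftrightarrow> x = z + y" for x y z :: "'a alg_closure"
      by (metis add.assoc add_0_right add_self)
    thus ?thesis
      using elem_trace_odd_mult[OF that(1,3)] by (auto simp: twist_def that(2))
  qed
  have half: "even n \<and> ext_degree \<beta> dvd n div 2 \<longleftrightarrow> even d"
    if "n = d * ext_degree \<beta>" for \<beta> :: "'a alg_closure" and d
  proof
    assume "even d"
    then obtain c where "d = 2 * c" ..
    thus "even n \<and> ext_degree \<beta> dvd n div 2" using that by simp
  next
    assume "even n \<and> ext_degree \<beta> dvd n div 2"
    then obtain c where "n = 2 * (ext_degree \<beta> * c)"
      by (metis dvd_def dvd_mult_div_cancel)
    hence "d * ext_degree \<beta> = (2 * c) * ext_degree \<beta>" using that by (simp add: ac_simps)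
    moreover have "ext_degree \<beta> \<noteq> 0" using that n by auto
    ultimately show "even d" by (simp only: mult_cancel2) simp
  qed
  show ?thesis
  proof (intro equalityI subsetI)
    fix \<beta> assume "\<beta> \<in> odd_index_elems n t s"
    hence \<beta>: "\<beta> \<in> GF_ext n" "elem_trace n \<beta> = to_ac t \<and> elem_subtrace n \<beta> = to_ac s"
        "\<not> (even n \<and> \<beta> \<in> GF_ext (n div 2))"
      by (auto simp: odd_index_elems_def)
    note deg = GF_ext_iff_ext_degree_dvd[OF \<beta>(1) n] ext_degree[OF \<beta>(1) n]
    obtain d where d: "n = d * ext_degree \<beta>"
      using deg(1)[of n] \<beta>(1) by (metis dvdE mult.commute)
    have "odd d" using half[OF d] \<beta>(3) deg(1) by blast
    moreover have "n div d = ext_degree \<beta>" using n by (subst d) (use d in auto)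
    ultimately have "\<beta> \<in> primitive_elems (n div d) t (s + twist t d)"
      using *[OF deg(3) d] \<beta>(2) deg(3) by (simp add: primitive_elems_def)
    thus "\<beta> \<in> (\<Union>d\<in>{d. d dvd n \<and> odd d}. primitive_elems (n div d) t (s + twist t d))"
      using d \<open>odd d\<close> by (metis (mono_tags, lifting) UN_I dvd_triv_left mem_Collect_eq)
  next
    fix \<beta> assume "\<beta> \<in> (\<Union>d\<in>{d. d dvd n \<and> odd d}. primitive_elems (n div d) t (s + twist t d))"
    then obtain d where d: "d dvd n" "odd d" "\<beta> \<in> primitive_elems (n div d) t (s + twist t d)"
      by blast
    define e where "e = n div d"
    have e: "n = d * e" using d(1) by (simp add: e_def)
    have \<beta>: "\<beta> \<in> GF_ext e" "ext_degree \<beta> = e" "elem_trace e \<beta> = to_ac t"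
        "elem_subtrace e \<beta> = to_ac (s + twist t d)"
      using d(3) by (auto simp: primitive_elems_def simp flip: e_def)
    have "\<beta> \<in> GF_ext n" using GF_ext_mult[OF \<beta>(1)] e by simp
    moreover have "\<not> (even n \<and> \<beta> \<in> GF_ext (n div 2))"
      using half[of d \<beta>] e \<beta>(2) d(2) GF_ext_iff_ext_degree_dvd[OF \<open>\<beta> \<in> GF_ext n\<close> n] by simp
    ultimately show "\<beta> \<in> odd_index_elems n t s"
      using *[OF \<beta>(1) e d(2)] \<beta> by (simp add: odd_index_elems_def)
  qed
qed

lemma card_odd_index_elems:
  assumes n: "n > 0"
  shows "card (odd_index_elems n t s) =
    (\<Sum>d | d dvd n \<and> odd d. (n div d) * P (n div d) t (s + twist t d :: 'a))"
proof -
  have pos: "n div d > 0" if "d dvd n" for d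
    using that n by (auto elim!: dvdE)
  have "card (odd_index_elems n t s) =
      (\<Sum>d | d dvd n \<and> odd d. card (primitive_elems (n div d) t (s + twist t d)))"
    unfolding odd_index_elems_eq_UN[OF n]
  proof (rule card_UN_disjoint)
    show "finite {d. d dvd n \<and> odd d}"
      by (rule finite_subset[of _ "{d. d dvd n}"]) (use n in auto)
    have "finite (GF_ext (n div d) :: 'a alg_closure set)" if "d dvd n" for d
      using finite_GF_ext_card[OF q k_pos] pos[OF that] by simp
    thus "\<forall>d\<in>{d. d dvd n \<and> odd d}. finite (primitive_elems (n div d) t (s + twist t d))"
      by (auto intro: finite_subset simp: primitive_elems_def)
    show "\<forall>d\<in>{d. d dvd n \<and> odd d}. \<forall>d'\<in>{d. d dvd n \<and> odd d}. d \<noteq> d' \<longrightarrow>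
        primitive_elems (n div d) t (s + twist t d) \<inter> primitive_elems (n div d') t (s + twist t d') = {}"
    proof (intro ballI impI, rule ccontr)
      fix d d' assume d: "d \<in> {d. d dvd n \<and> odd d}" "d' \<in> {d. d dvd n \<and> odd d}" "d \<noteq> d'"
        and "primitive_elems (n div d) t (s + twist t d) \<inter> primitive_elems (n div d') t (s + twist t d') \<noteq> {}"
      hence "n div d = n div d'" by (auto simp: primitive_elems_def)
      thus False using d n by (metis div_div_eq_right div_mult_self_is_m dvd_div_eq_mult mem_Collect_eq
        dvd_mult_div_cancel mult_right_cancel pos not_less_zero)
    qed
  qed
  also have "\<dots> = (\<Sum>d | d dvd n \<and> odd d. (n div d) * P (n div d) t (s + twist t d))"
    using pos by (intro sum.cong refl card_primitive_elems) auto
  finally show ?thesis .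
qed

text \<open>The excluded elements have trace 0, so the exclusion removes nothing here.\<close>

lemma card_odd_index_elems_trace_nonzero:
  assumes "(t :: 'a) \<noteq> 0"
  shows "card (odd_index_elems n t s) = F n t s"
proof -
  have "elem_trace n \<beta> = 0" if "even n" "\<beta> \<in> GF_ext (n div 2)" for \<beta> :: "'a alg_closure"
    using elem_trace_double(1)[OF that(2)] that(1) by simp
  hence "odd_index_elems n t s = {\<beta> \<in> GF_ext n. elem_trace n \<beta> = to_ac t \<and> elem_subtrace n \<beta> = to_ac s}"
    using assms by (auto simp: odd_index_elems_def)
  thus ?thesis by (simp add: F_def)
qed

text \<open>For even \<open>n\<close> the excluded elements are those of
  \<open>GF_ext (n div 2)\<close> whose squared trace at that level is \<open>s\<close>;
  \<open>card_elem_trace_squared\<close> counts them.\<close>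

lemma card_odd_index_elems_trace_0:
  assumes n: "n > 0"
  shows "int (card (odd_index_elems n 0 (s :: 'a))) =
    int (F n 0 s) - of_bool (even n) * int CARD('a) ^ (n div 2 - 1)"
proof (cases "even n")
  case True
  define m where "m = n div 2"
  have nm: "n = 2 * m" "m > 0" using True n by (auto simp: m_def)
  let ?H = "{\<beta> \<in> GF_ext m. (elem_trace m \<beta>)\<^sup>2 = to_ac s}"
  have fin: "finite (GF_ext r :: 'a alg_closure set)" if "r > 0" for r
    using finite_GF_ext_card[OF q k_pos] that by simp
  have "{\<beta> \<in> GF_ext n. elem_trace n \<beta> = to_ac 0 \<and> elem_subtrace n \<beta> = to_ac s} =
      odd_index_elems n 0 s \<union> ?H"
    using elem_trace_double GF_ext_mult by (auto simp: odd_index_elems_def nm)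
  moreover have "odd_index_elems n 0 s \<inter> ?H = {}"
    by (auto simp: odd_index_elems_def nm)
  moreover have "finite (odd_index_elems n 0 s)" "finite ?H"
    using fin[OF n] fin[OF nm(2)] by (auto simp: odd_index_elems_def)
  ultimately have "F n 0 s = card (odd_index_elems n 0 s) + card ?H"
    by (simp add: F_def card_Un_disjoint)
  thus ?thesis
    using True nm by (simp add: card_elem_trace_squared)
qed (simp add: odd_index_elems_def F_def)

text \<open>A product of odd numbers is 3 modulo 4 iff exactly one factor is, and two shifts by the
  square of \<open>t\<close> cancel. This additivity is what \<open>moebius_inversion_odd\<close>
  needs.\<close>

lemma twist_mult:
  assumes "odd c" "odd d"
  shows "twist (t :: 'a) (c * d) = twist t c + twist t d"
proof -
  have "to_ac (t\<^sup>2 + t\<^sup>2) = to_ac (0 :: 'a)"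
    by (simp only: to_ac_add to_ac_0 add_self)
  hence self: "t\<^sup>2 + t\<^sup>2 = 0" by (simp only: to_ac_eq_iff)
  have "c mod 4 = 1 \<or> c mod 4 = 3" "d mod 4 = 1 \<or> d mod 4 = 3"
    using assms by presburger+
  hence "c * d mod 4 = 3 \<longleftrightarrow> (c mod 4 = 3) \<noteq> (d mod 4 = 3)"
    using mod_mult_eq[of c 4 d] by (elim disjE; simp)
  thus ?thesis using self by (auto simp: twist_def)
qed

lemma moebius_inversion_P:
  assumes n: "n > 0"
  shows "(\<Sum>d | d dvd n \<and> odd d. moebius d * int (card (odd_index_elems (n div d) t (s + twist t d)))) =
    int n * int (P n t (s :: 'a))"
proof -
  have "(\<Sum>d | d dvd n \<and> odd d. moebius d * int (card (odd_index_elems (n div d) t (s + twist t d)))) =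
      int n * int (P n t (s + twist t 1))"
    by (rule moebius_inversion_odd[where a = "\<lambda>c m. int m * int (P m t (s + twist t c))"])
       (simp_all add: card_odd_index_elems twist_mult add.assoc n)
  thus ?thesis by (simp add: twist_def)
qed

end

theorem theorem1:
  fixes t s :: "'a :: finite_field" and n k :: nat
  assumes "CARD('a) = 2 ^ k" and "k \<ge> 1" and "n > 0" and "t \<noteq> 0"
  shows "int n * int (P n 0 s) =
           (\<Sum>d | d dvd n \<and> odd d.
              moebius d * (int (F (n div d) 0 s)
                - of_bool (even n) * int (CARD('a)) ^ (n div (2 * d) - 1)))
       \<and> int n * int (P n t s) =
           (\<Sum>d | d dvd n \<and> d mod 4 = 1. moebius d * int (F (n div d) t s))
           + (\<Sum>d | d dvd n \<and> d mod 4 = 3. moebius d * int (F (n div d) t (t\<^sup>2 + s)))"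
proof
  have zero: "int (card (odd_index_elems (n div d) 0 (s + twist 0 d))) =
      int (F (n div d) 0 s) - of_bool (even n) * int CARD('a) ^ (n div (2 * d) - 1)"
    if d: "d dvd n" "odd d" for d
  proof -
    obtain e where "n = d * e" using d(1) by (rule dvdE)
    hence "n div d > 0" "even (n div d) \<longleftrightarrow> even n"
      using d(2) assms(3) by auto
    \<comment> \<open>The count at level \<open>n div d\<close> yields the exponent
      \<open>n div d div 2 - 1\<close>, here brought to the form in the theorem.\<close>
    moreover have "n div d div 2 = n div (2 * d)"
      by (simp add: div_mult2_eq[symmetric] mult.commute)
    ultimately show ?thesis
      by (simp add: card_odd_index_elems_trace_0[OF assms(1)] twist_def)
  qed
  show "int n * int (P n 0 s) =
      (\<Sum>d | d dvd n \<and> odd d. moebius d * (int (F (n div d) 0 s)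
        - of_bool (even n) * int (CARD('a)) ^ (n div (2 * d) - 1)))"
    unfolding moebius_inversion_P[OF assms(1,3), symmetric] by (intro sum.cong refl) (simp add: zero)
  \<comment> \<open>The two odd residue classes are separated because \<open>twist t d\<close> is 0
    on the first and the square of \<open>t\<close> on the second.\<close>
  have "odd d \<longleftrightarrow> d mod 4 = 1 \<or> d mod 4 = 3" for d :: nat
    by presburger
  hence split: "{d. d dvd n \<and> odd d} = {d. d dvd n \<and> d mod 4 = 1} \<union> {d. d dvd n \<and> d mod 4 = 3}"
    by blast
  let ?A = "{d. d dvd n \<and> d mod 4 = 1}" and ?B = "{d. d dvd n \<and> d mod 4 = 3}"
  let ?g = "\<lambda>d. moebius d * int (F (n div d) t (s + twist t d))"
  have "int n * int (P n t s) = (\<Sum>d | d dvd n \<and> odd d. ?g d)"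
    unfolding moebius_inversion_P[OF assms(1,3), symmetric]
    by (simp add: card_odd_index_elems_trace_nonzero[OF assms(1,4)])
  also note split
  also have "(\<Sum>d\<in>?A \<union> ?B. ?g d) = (\<Sum>d\<in>?A. ?g d) + (\<Sum>d\<in>?B. ?g d)"
    using assms(3) by (intro sum.union_disjoint) auto
  also have "(\<Sum>d\<in>?A. ?g d) = (\<Sum>d\<in>?A. moebius d * int (F (n div d) t s))"
    by (intro sum.cong refl) (simp add: twist_def)
  also have "(\<Sum>d\<in>?B. ?g d) = (\<Sum>d\<in>?B. moebius d * int (F (n div d) t (t\<^sup>2 + s)))"
    by (intro sum.cong refl) (simp add: twist_def add.commute)
  finally show "int n * int (P n t s) =
      (\<Sum>d | d dvd n \<and> d mod 4 = 1. moebius d * int (F (n div d) t s))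
      + (\<Sum>d | d dvd n \<and> d mod 4 = 3. moebius d * int (F (n div d) t (t\<^sup>2 + s)))" .
qed

end
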